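(* Let $0<p,q\le1$, let $h:[0,\infty)\times[0,\infty)\to\mathbb{R}$ be continuous and of exponential order $(a,b)$, and let $G_{p.q}(r,s)=\mathcal{G}_x^p\mathcal{G}_t^q\left[h\left(\frac{x^p}{p},\frac{t^q}{q}\right)\right](r,s)$. Assume that the conformable partial derivative occurring on the left-hand side ($\frac{\partial^q}{\partial t^q}h$ in (i), $\frac{\partial^p}{\partial x^p}h$ in (ii)) exists for all $x,t>0$ and, as a function of $(u,v)=\left(\frac{x^p}{p},\frac{t^q}{q}\right)$, is piecewise continuous and of exponential order $(a,b)$. Then for all $r,s\in\mathbb{C}\setminus\{0\}$ with $\operatorname{Re}(r)>a$, $\operatorname{Re}(s)>b$: (i) $\displaystyle \mathcal{G}_x^p\mathcal{G}_t^q\left[\frac{x^p}{p}\frac{\partial^q}{\partial t^q}h\left(\frac{x^p}{p},\frac{t^q}{q}\right)\right]=-rs\frac{\partial}{\partial r}\left(\frac1r\,G_{p.q}(r,s)\right)+rs\frac{d}{dr}\left(\frac1r\,\mathcal{G}_x^p\left[h\left(\frac{x^p}{p},0\right)\right]\right).$ (ii) $\displaystyle \mathcal{G}_x^p\mathcal{G}_t^q\left[\frac{t^q}{q}\frac{\partial^p}{\partial x^p}h\left(\frac{x^p}{p},\frac{t^q}{q}\right)\right]=-rs\frac{\partial}{\partial s}\left(\frac1s\,G_{p.q}(r,s)\right)+rs\frac{d}{ds}\left(\frac1s\,\mathcal{G}_t^q\left[h\left(0,\frac{t^q}{q}\right)\right]\right).$ Here double transforms are evaluated at $(r,s)$, transforms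 $\mathcal{G}_x^p$ at $r$ and transforms $\mathcal{G}_t^q$ at $s$.
   Context: Conformable double ARA transform (CDARAT): for $0<p,q\le1$ and a function $h(u,v)$ on $[0,\infty)\times[0,\infty)$, $$\mathcal{G}_x^p\mathcal{G}_t^q\left[h\left(\tfrac{x^p}{p},\tfrac{t^q}{q}\right)\right](r,s)=rs\int_0^\infty\int_0^\infty e^{-r\frac{x^p}{p}-s\frac{t^q}{q}}\,h\left(\tfrac{x^p}{p},\tfrac{t^q}{q}\right)x^{p-1}t^{q-1}\,dx\,dt,\qquad r,s\in\mathbb{C}.$$ Single conformable ARA transforms: $\mathcal{G}_x^p\left[f\left(\tfrac{x^p}{p}\right)\right](r)=r\int_0^\infty e^{-r\frac{x^p}{p}}f\left(\tfrac{x^p}{p}\right)x^{p-1}\,dx$ and $\mathcal{G}_t^q\left[g\left(\tfrac{t^q}{q}\right)\right](s)=s\int_0^\infty e^{-s\frac{t^q}{q}}g\left(\tfrac{t^q}{q}\right)t^{q-1}\,dt$. A function $h$ is of exponential order $(a,b)$, $a,b\in\mathbb{R}$, if $\sup_{u,v>0}\dfrac{|h(u,v)|}{e^{au+bv}}<\infty$. Conformable partial derivatives: writing $F(x,t)=h\left(\tfrac{x^p}{p},\tfrac{t^q}{q}\right)$, for $x,t>0$, $$\frac{\partial^p}{\partial x^p}h\left(\tfrac{x^p}{p},\tfrac{t^q}{q}\right)=\lim_{\delta\to0}\frac{F(x+\delta x^{1-p},t)-F(x,t)}{\delta},\qquad \frac{\partial^q}{\partial t^q}h\left(\tfrac{x^p}{p},\tfrac{t^q}{q}\right)=\lim_{\xi\to0}\frac{F(x,t+\xi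 t^{1-q})-F(x,t)}{\xi},$$ so that (for differentiable $F$) these equal $x^{1-p}\,\partial F/\partial x$ and $t^{1-q}\,\partial F/\partial t$. *)

theory Defs
  imports "HOL-Analysis.Analysis"
begin

text \<open>
  The transforms act on functions of the original variables \<open>x, t > 0\<close>. Integrals are absolutely
  convergent Lebesgue integrals; the coordinate axes form a null set and are left out because
  conformable derivatives are only defined for positive arguments. The existence predicates below
  keep track of convergence, since a divergent Bochner integral has the value 0.
\<close>

definition cdarat_integrand ::
    "real \<Rightarrow> real \<Rightarrow> (real \<Rightarrow> real \<Rightarrow> real) \<Rightarrow> complex \<Rightarrow> complex \<Rightarrow> real \<times> real \<Rightarrow> complex" where
  "cdarat_integrand p q F r s = (\<lambda>(x, t).
     exp (- r * of_real (x powr p / p) - s * of_real (t powr q / q))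
       * of_real (F x t) * of_real (x powr (p - 1)) * of_real (t powr (q - 1)))"

definition cdarat_exists ::
    "real \<Rightarrow> real \<Rightarrow> (real \<Rightarrow> real \<Rightarrow> real) \<Rightarrow> complex \<Rightarrow> complex \<Rightarrow> bool" where
  "cdarat_exists p q F r s \<longleftrightarrow>
     set_integrable lborel ({0<..} \<times> {0<..}) (cdarat_integrand p q F r s)"

definition cdarat ::
    "real \<Rightarrow> real \<Rightarrow> (real \<Rightarrow> real \<Rightarrow> real) \<Rightarrow> complex \<Rightarrow> complex \<Rightarrow> complex" where
  "cdarat p q F r s =
     r * s * (LINT z:{0<..} \<times> {0<..}|lborel. cdarat_integrand p q F r s z)"

definition cara_integrand :: "real \<Rightarrow> (real \<Rightarrow> real) \<Rightarrow> complex \<Rightarrow> real \<Rightarrow> complex" where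
  "cara_integrand p f r = (\<lambda>x.
     exp (- r * of_real (x powr p / p)) * of_real (f x) * of_real (x powr (p - 1)))"

definition cara_exists :: "real \<Rightarrow> (real \<Rightarrow> real) \<Rightarrow> complex \<Rightarrow> bool" where
  "cara_exists p f r \<longleftrightarrow> set_integrable lborel {0<..} (cara_integrand p f r)"

definition cara :: "real \<Rightarrow> (real \<Rightarrow> real) \<Rightarrow> complex \<Rightarrow> complex" where
  "cara p f r = r * (LINT x:{0<..}|lborel. cara_integrand p f r x)"

definition exponential_order :: "real \<Rightarrow> real \<Rightarrow> (real \<Rightarrow> real \<Rightarrow> real) \<Rightarrow> bool" where
  "exponential_order a b h \<longleftrightarrow>
     bdd_above ((\<lambda>(u, v). \<bar>h u v\<bar> / exp (a * u + b * v)) ` ({0<..} \<times> {0<..}))"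

definition conformable_quotient :: "real \<Rightarrow> (real \<Rightarrow> real) \<Rightarrow> real \<Rightarrow> real \<Rightarrow> real" where
  "conformable_quotient \<alpha> f x \<delta> = (f (x + \<delta> * x powr (1 - \<alpha>)) - f x) / \<delta>"

definition conformable_differentiable :: "real \<Rightarrow> (real \<Rightarrow> real) \<Rightarrow> real \<Rightarrow> bool" where
  "conformable_differentiable \<alpha> f x \<longleftrightarrow> (\<exists>D. (conformable_quotient \<alpha> f x \<longlongrightarrow> D) (at 0))"

definition conformable_deriv :: "real \<Rightarrow> (real \<Rightarrow> real) \<Rightarrow> real \<Rightarrow> real" where
  "conformable_deriv \<alpha> f x = Lim (at 0) (conformable_quotient \<alpha> f x)"

definition conformable_arg ::
    "real \<Rightarrow> real \<Rightarrow> (real \<Rightarrow> real \<Rightarrow> real) \<Rightarrow> real \<Rightarrow> real \<Rightarrow> real" where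
  "conformable_arg p q h = (\<lambda>x t. h (x powr p / p) (t powr q / q))"

definition conformable_dx ::
    "real \<Rightarrow> real \<Rightarrow> (real \<Rightarrow> real \<Rightarrow> real) \<Rightarrow> real \<Rightarrow> real \<Rightarrow> real" where
  "conformable_dx p q h x t = conformable_deriv p (\<lambda>x'. conformable_arg p q h x' t) x"

definition conformable_dt ::
    "real \<Rightarrow> real \<Rightarrow> (real \<Rightarrow> real \<Rightarrow> real) \<Rightarrow> real \<Rightarrow> real \<Rightarrow> real" where
  "conformable_dt p q h x t = conformable_deriv q (\<lambda>t'. conformable_arg p q h x t') t"

text \<open>
  A function \<open>K\<close> of \<open>(x, t)\<close> rewritten as a function of \<open>u = x powr p / p\<close>, \<open>v = t powr q / q\<close>.
\<close>

definition as_function_of_uv ::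
    "real \<Rightarrow> real \<Rightarrow> (real \<Rightarrow> real \<Rightarrow> real) \<Rightarrow> real \<Rightarrow> real \<Rightarrow> real" where
  "as_function_of_uv p q K = (\<lambda>u v. K ((p * u) powr (1 / p)) ((q * v) powr (1 / q)))"

lemma as_function_of_uv_conformable_arg:
  assumes "p > 0" "q > 0" "u > 0" "v > 0"
  shows "as_function_of_uv p q (conformable_arg p q h) u v = h u v"
  using assms by (simp add: as_function_of_uv_def conformable_arg_def powr_powr)

text \<open>
  Piecewise continuity on the open quadrant: every bounded rectangle is cut into finitely many open
  pieces with boundary of measure zero, and on each piece the function extends continuously to the
  closure of the piece within the open quadrant. Values on the boundaries of the pieces are
  arbitrary. The pieces need not be rectangles, and no limits are required at the coordinate axes,
  so every function that is continuous on the open quadrant qualifies.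
\<close>

definition piecewise_continuous :: "(real \<Rightarrow> real \<Rightarrow> real) \<Rightarrow> bool" where
  "piecewise_continuous f \<longleftrightarrow>
     (\<forall>X>0. \<forall>T>0. \<exists>\<R>. finite \<R> \<and> disjoint \<R> \<and>
        {0<..<X} \<times> {0<..<T} \<subseteq> (\<Union>R\<in>\<R>. closure R) \<and>
        (\<forall>R\<in>\<R>. R \<subseteq> {0<..<X} \<times> {0<..<T} \<and> open R \<and> negligible (frontier R) \<and>
           (\<exists>g. continuous_on (closure R \<inter> {0<..} \<times> {0<..}) g \<and>
                (\<forall>(u, v)\<in>R. g (u, v) = f u v))))"

lemma continuous_imp_piecewise_continuous:
  assumes "continuous_on ({0<..} \<times> {0<..}) (\<lambda>(u, v). f u v)"
  shows "piecewise_continuous f"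
  unfolding piecewise_continuous_def
proof (intro allI impI)
  fix X T :: real
  assume "X > 0" "T > 0"
  let ?R = "{0<..<X} \<times> {0<..<T}"
  have box: "?R = box (0, 0) (X, T)"
    by (auto simp: box_def Basis_prod_def)
  have "continuous_on (closure ?R \<inter> {0<..} \<times> {0<..}) (\<lambda>(u, v). f u v)"
    using assms by (rule continuous_on_subset) auto
  moreover have "negligible (frontier ?R)"
    unfolding box by (intro negligible_convex_frontier convex_box)
  moreover have "open ?R"
    by (intro open_Times) auto
  moreover have "?R \<subseteq> (\<Union>R\<in>{?R}. closure R)"
    using closure_subset[of ?R] by simp
  ultimately show "\<exists>\<R>. finite \<R> \<and> disjoint \<R> \<and> ?R \<subseteq> (\<Union>R\<in>\<R>. closure R) \<and>
      (\<forall>R\<in>\<R>. R \<subseteq> ?R \<and> open R \<and> negligible (frontier R) \<and>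
         (\<exists>g. continuous_on (closure R \<inter> {0<..} \<times> {0<..}) g \<and> (\<forall>(u, v)\<in>R. g (u, v) = f u v)))"
    by (intro exI[of _ "{?R}"] conjI ballI) (auto simp: disjoint_def intro!: exI[of _ "\<lambda>(u, v). f u v"])
qed

end

theory Submission
  imports Defs "HOL-Real_Asymp.Real_Asymp"
begin

text \<open>
  With \<open>u = x powr p / p\<close> and \<open>v = t powr q / q\<close> the transforms are Laplace transforms in \<open>u\<close> and \<open>v\<close>
  multiplied by the parameters, since \<open>x powr (p - 1)\<close> is the derivative of \<open>u\<close>; and conformable
  derivatives are ordinary derivatives in \<open>u\<close> and \<open>v\<close>. The statement therefore combines two classical
  rules: a derivative in \<open>v\<close> becomes multiplication by \<open>s\<close> minus the boundary values at \<open>v = 0\<close>, and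
  multiplication by \<open>u\<close> turns the transform \<open>G\<close> into \<open>- r * d/dr (G / r)\<close>. The substitutions for
  \<open>u\<close> and \<open>v\<close> serve as a guide only; the integrals are treated in the variables \<open>x\<close> and \<open>t\<close>.

  The first rule is integration by parts in \<open>t\<close> on almost every slice (\<open>cara_conformable_deriv\<close>),
  integrated over \<open>x\<close> by Fubini (\<open>cdarat_conformable_dt\<close>). The second is differentiation under the
  integral sign, done once for Laplace integrals over any measure space
  (\<open>has_field_derivative_exp_integral\<close>). Since \<open>u\<close> does not depend on \<open>t\<close>, applying the first rule to
  \<open>u * h\<close> in place of \<open>h\<close> and then the second rule to its right-hand side gives part (i)
  (\<open>cdarat_powr_mult_conformable_dt\<close>). All integrals converge by comparison with the exponential bounds.
  Part (ii) is part (i) with the two variables exchanged (\<open>cdarat_swap\<close>).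
\<close>

section \<open>The conformable kernel and its weight\<close>

lemma DERIV_powr_divide:
  fixes p x :: real
  assumes "p > 0" "x > 0"
  shows "((\<lambda>x. x powr p / p) has_real_derivative x powr (p - 1)) (at x)"
  using assms by (auto intro!: derivative_eq_intros)

lemma filterlim_powr_divide_at_top:
  fixes p :: real
  assumes "p > 0"
  shows "filterlim (\<lambda>x. x powr p / p) at_top at_top"
proof -
  have "filterlim (\<lambda>x::real. x powr p) at_top at_top"
    using assms by real_asymp
  then have "filterlim (\<lambda>x::real. (1 / p) * x powr p) at_top at_top"
    using assms by (intro filterlim_tendsto_pos_mult_at_top[OF tendsto_const]) auto
  then show ?thesis by simp
qed

text \<open>
  The weight \<open>x powr (p - 1)\<close> is the derivative of the argument \<open>x powr p / p\<close>, so the integrand has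
  the antiderivative \<open>- exp (- c * (x powr p / p)) / c\<close>. For \<open>p < 1\<close> the weight is unbounded at \<open>0\<close>,
  hence the fundamental theorem is applied on the open half-line, with limits at both ends. This is
  the dominating function behind every convergence statement below.
\<close>

lemma set_integrable_exp_powr:
  fixes p c :: real
  assumes "p > 0" "c > 0"
  shows "set_integrable lborel {0<..} (\<lambda>x. exp (- c * (x powr p / p)) * x powr (p - 1))"
proof -
  let ?F = "\<lambda>x. - (1 / c) * exp (- c * (x powr p / p))"
  have 1: "(?F \<longlongrightarrow> - (1 / c) * exp (- c * 0)) (at_right 0)"
  proof -
    have "((\<lambda>x::real. x powr p) \<longlongrightarrow> 0 powr p) (at_right 0)"
      using assms by (intro tendsto_powr') (auto simp: eventually_at_filter)
    then have "((\<lambda>x::real. x powr p / p) \<longlongrightarrow> 0 / p) (at_right 0)"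
      using assms by (intro tendsto_divide) auto
    then show ?thesis by (intro tendsto_intros) auto
  qed
  have 2: "(?F \<longlongrightarrow> - (1 / c) * 0) at_top"
  proof (intro tendsto_mult tendsto_const)
    have "filterlim (\<lambda>x. c * (x powr p / p)) at_top at_top"
      using assms by (intro filterlim_tendsto_pos_mult_at_top[OF tendsto_const] filterlim_powr_divide_at_top)
    then show "((\<lambda>x. exp (- c * (x powr p / p))) \<longlongrightarrow> 0) at_top"
      by (intro filterlim_compose[OF exp_at_bot]) (simp add: filterlim_uminus_at_bot)
  qed
  have "set_integrable lborel (einterval 0 \<infinity>) (\<lambda>x. exp (- c * (x powr p / p)) * x powr (p - 1))"
  proof (rule interval_integral_FTC_nonneg(1))
    fix x :: real assume "0 < ereal x"
    then have x: "x > 0" by simp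
    show "(?F has_real_derivative exp (- c * (x powr p / p)) * x powr (p - 1)) (at x)"
      using assms x by (auto intro!: derivative_eq_intros DERIV_powr_divide)
    show "isCont (\<lambda>x. exp (- c * (x powr p / p)) * x powr (p - 1)) x"
      using assms x by (intro continuous_intros) auto
  next
    show "((?F \<circ> real_of_ereal) \<longlongrightarrow> - (1 / c) * exp (- c * 0)) (at_right 0)"
      using 1 by (simp add: zero_ereal_def ereal_tendsto_simps1)
    show "((?F \<circ> real_of_ereal) \<longlongrightarrow> - (1 / c) * 0) (at_left \<infinity>)"
      using 2 unfolding ereal_tendsto_simps1 .
  qed auto
  moreover have "einterval 0 \<infinity> = {0<..}"
    by (auto simp: einterval_def)
  ultimately show ?thesis by simp
qed

lemma exp_mult_exp_shift:
  fixes u v a b c d :: real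
  shows "exp (a * u) * exp (- c * u) = exp (- (c - a) * u)"
    and "exp (- c * u - d * v) * exp (a * u + b * v) = exp (- (c - a) * u) * exp (- (d - b) * v)"
  by (simp_all add: exp_add[symmetric] algebra_simps)

text \<open>
  The polynomial factor \<open>u\<close> is absorbed by a slightly larger growth rate.
\<close>

lemma mult_exp_le_exp:
  fixes u v a b c :: real
  assumes "a < c"
  shows "u * exp (a * u + b * v) \<le> 1 / (c - a) * exp (c * u + b * v)"
proof -
  have "(c - a) * u \<le> exp ((c - a) * u)"
    using exp_ge_add_one_self[of "(c - a) * u"] by linarith
  then have "u \<le> 1 / (c - a) * exp ((c - a) * u)"
    using assms by (simp add: field_simps)
  then have "u * exp (a * u + b * v) \<le> 1 / (c - a) * exp ((c - a) * u) * exp (a * u + b * v)"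
    by (rule mult_right_mono) simp
  also have "\<dots> = 1 / (c - a) * exp (c * u + b * v)"
    by (simp add: exp_add[symmetric] algebra_simps)
  finally show ?thesis .
qed

section \<open>Conformable derivatives\<close>

lemma conformable_deriv_limit:
  assumes "conformable_differentiable \<alpha> f x"
  shows "(conformable_quotient \<alpha> f x \<longlongrightarrow> conformable_deriv \<alpha> f x) (at 0)"
  using assms unfolding conformable_differentiable_def conformable_deriv_def
  by (metis tendsto_Lim trivial_limit_at)

text \<open>
  Substituting \<open>\<delta> * x powr (\<alpha> - 1)\<close> for the increment turns the conformable quotient into the
  ordinary one, because \<open>x powr (\<alpha> - 1)\<close> and \<open>x powr (1 - \<alpha>)\<close> are mutually inverse. Hence the
  conformable derivative times the weight of the transform is the ordinary derivative.
\<close>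

lemma conformable_deriv_imp_DERIV:
  assumes "conformable_differentiable \<alpha> f x" "x > 0"
  shows "(f has_real_derivative conformable_deriv \<alpha> f x * x powr (\<alpha> - 1)) (at x)"
proof -
  have "filterlim (\<lambda>\<delta>. \<delta> * x powr (\<alpha> - 1)) (nhds (0 * x powr (\<alpha> - 1))) (at 0)"
    by (intro tendsto_intros)
  then have "filterlim (\<lambda>\<delta>. \<delta> * x powr (\<alpha> - 1)) (at 0) (at 0)"
    using assms(2) by (auto simp: filterlim_at eventually_at_filter)
  from filterlim_compose[OF conformable_deriv_limit[OF assms(1)] this]
  have "((\<lambda>\<delta>. conformable_quotient \<alpha> f x (\<delta> * x powr (\<alpha> - 1)) * x powr (\<alpha> - 1))
      \<longlongrightarrow> conformable_deriv \<alpha> f x * x powr (\<alpha> - 1)) (at 0)"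
    by (intro tendsto_mult tendsto_const)
  moreover have "conformable_quotient \<alpha> f x (\<delta> * x powr (\<alpha> - 1)) * x powr (\<alpha> - 1)
      = (f (x + \<delta>) - f x) / \<delta>" for \<delta>
  proof -
    have "x powr (\<alpha> - 1) * x powr (1 - \<alpha>) = 1"
      using assms(2) by (simp flip: powr_add)
    then show ?thesis
      using assms(2) by (simp add: conformable_quotient_def mult.assoc)
  qed
  ultimately show ?thesis by (simp add: DERIV_def)
qed

lemma conformable_deriv_cmult:
  assumes "conformable_differentiable \<alpha> f x"
  shows "conformable_differentiable \<alpha> (\<lambda>x. c * f x) x"
    and "conformable_deriv \<alpha> (\<lambda>x. c * f x) x = c * conformable_deriv \<alpha> f x"
proof -
  have "conformable_quotient \<alpha> (\<lambda>x. c * f x) x = (\<lambda>\<delta>. c * conformable_quotient \<alpha> f x \<delta>)"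
    by (simp add: fun_eq_iff conformable_quotient_def right_diff_distrib)
  with tendsto_mult[OF tendsto_const conformable_deriv_limit[OF assms]]
  have lim: "(conformable_quotient \<alpha> (\<lambda>x. c * f x) x \<longlongrightarrow> c * conformable_deriv \<alpha> f x) (at 0)"
    by simp
  then show "conformable_differentiable \<alpha> (\<lambda>x. c * f x) x"
    unfolding conformable_differentiable_def by blast
  from lim show "conformable_deriv \<alpha> (\<lambda>x. c * f x) x = c * conformable_deriv \<alpha> f x"
    unfolding conformable_deriv_def by (intro tendsto_Lim) auto
qed

text \<open>
  The derivative is a pointwise limit of the quotients with increments \<open>1 / (n + 1)\<close>, each of which is
  continuous in both variables.
\<close>

lemma set_borel_measurable_conformable_deriv:
  fixes F :: "real \<Rightarrow> real \<Rightarrow> real"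
  assumes cont: "continuous_on ({0<..} \<times> {0<..}) (\<lambda>(x, t). F x t)"
    and diff: "\<And>x t. x > 0 \<Longrightarrow> t > 0 \<Longrightarrow> conformable_differentiable q (F x) t"
  shows "set_borel_measurable lborel ({0<..} \<times> {0<..}) (\<lambda>(x, t). conformable_deriv q (F x) t)"
proof -
  let ?Q = "{0<..} \<times> {0<..} :: (real \<times> real) set"
  let ?\<delta> = "\<lambda>n. inverse (real (Suc n))"
  have "(\<lambda>z. indicator ?Q z *\<^sub>R (case z of (x, t) \<Rightarrow> conformable_deriv q (F x) t)) \<in> borel_measurable borel"
  proof (rule borel_measurable_LIMSEQ_real)
    fix n
    have "continuous_on ?Q (\<lambda>z. F (fst z) (snd z + ?\<delta> n * snd z powr (1 - q)))"
      by (rule continuous_on_compose2[OF cont, of _ "\<lambda>z. (fst z, snd z + ?\<delta> n * snd z powr (1 - q))",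
            unfolded case_prod_conv])
        (auto intro!: continuous_intros simp: add_pos_nonneg)
    then have "continuous_on ?Q (\<lambda>z. conformable_quotient q (F (fst z)) (snd z) (?\<delta> n))"
      unfolding conformable_quotient_def using cont
      by (intro continuous_intros) (auto simp: case_prod_beta)
    then show "(\<lambda>z. indicator ?Q z *\<^sub>R conformable_quotient q (F (fst z)) (snd z) (?\<delta> n))
        \<in> borel_measurable borel"
      by (intro borel_measurable_continuous_on_indicator borel_open open_Times) auto
  next
    fix z :: "real \<times> real"
    have \<delta>: "filterlim ?\<delta> (at 0) sequentially"
      using LIMSEQ_inverse_real_of_nat by (auto simp: filterlim_at simp del: of_nat_Suc)
    show "(\<lambda>n. indicator ?Q z *\<^sub>R conformable_quotient q (F (fst z)) (snd z) (?\<delta> n))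
        \<longlonglongrightarrow> indicator ?Q z *\<^sub>R (case z of (x, t) \<Rightarrow> conformable_deriv q (F x) t)"
    proof (cases "z \<in> ?Q")
      case True
      then show ?thesis
        using filterlim_compose[OF conformable_deriv_limit[OF diff] \<delta>] by auto
    qed simp
  qed
  then show ?thesis by (simp add: set_borel_measurable_def)
qed

section \<open>Convergence and iteration of the transforms\<close>

lemma cara_existsI:
  assumes "p > 0" and meas: "set_borel_measurable lborel {0<..} f"
    and bound: "\<And>x. x > 0 \<Longrightarrow> \<bar>f x\<bar> \<le> C * exp (a * (x powr p / p))"
    and "a < Re r"
  shows "cara_exists p f r"
  unfolding cara_exists_def set_integrable_def
proof (rule Bochner_Integration.integrable_bound)
  let ?D = "\<lambda>x. C * exp (- (Re r - a) * (x powr p / p)) * x powr (p - 1)"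
  have "set_integrable lborel {0<..} (\<lambda>x. C * (exp (- (Re r - a) * (x powr p / p)) * x powr (p - 1)))"
    using assms by (intro set_integrable_mult_right set_integrable_exp_powr) auto
  then show "integrable lborel (\<lambda>x. indicator {0<..} x *\<^sub>R ?D x)"
    by (simp add: set_integrable_def mult_ac)
  have [measurable]: "(\<lambda>x. indicator {0<..} x * f x) \<in> borel_measurable borel"
    using meas by (simp add: set_borel_measurable_def)
  have "(\<lambda>x. exp (- r * of_real (x powr p / p)) * of_real (indicator {0<..} x * f x)
      * of_real (x powr (p - 1))) \<in> borel_measurable lborel"
    by measurable
  then show "(\<lambda>x. indicator {0<..} x *\<^sub>R cara_integrand p f r x) \<in> borel_measurable lborel"
    by (rule measurable_cong[THEN iffD1, rotated]) (auto simp: cara_integrand_def indicator_def)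
  show "AE x in lborel. norm (indicator {0<..} x *\<^sub>R cara_integrand p f r x)
      \<le> norm (indicator {0<..} x *\<^sub>R ?D x)"
  proof (rule AE_I2)
    fix x :: real
    show "norm (indicator {0<..} x *\<^sub>R cara_integrand p f r x) \<le> norm (indicator {0<..} x *\<^sub>R ?D x)"
    proof (cases "x > 0")
      case True
      have "norm (cara_integrand p f r x) = exp (- Re r * (x powr p / p)) * x powr (p - 1) * \<bar>f x\<bar>"
        by (simp add: cara_integrand_def norm_mult)
      also have "\<dots> \<le> exp (- Re r * (x powr p / p)) * x powr (p - 1) * (C * exp (a * (x powr p / p)))"
        using True by (intro mult_left_mono bound) auto
      also have "\<dots> = C * (exp (a * (x powr p / p)) * exp (- Re r * (x powr p / p))) * x powr (p - 1)"
        by (simp add: mult_ac)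
      also have "\<dots> = ?D x"
        by (simp only: exp_mult_exp_shift)
      also have "\<dots> \<le> norm (?D x)" by simp
      finally show ?thesis using True by simp
    qed simp
  qed
qed

lemma integrable_lborel_tensor:
  fixes f g :: "real \<Rightarrow> real"
  assumes [measurable]: "integrable lborel f" "integrable lborel g"
  shows "integrable lborel (\<lambda>(x, t). f x * g t)"
proof -
  have "integrable (lborel \<Otimes>\<^sub>M lborel) (\<lambda>(x, t). f x * g t)"
    by (rule lborel_pair.Fubini_integrable) (use assms in \<open>auto simp: abs_mult\<close>)
  then show ?thesis by (simp add: lborel_prod)
qed

text \<open>
  The exponential bound on \<open>H\<close> dominates the integrand by a product of a function of \<open>x\<close> and a
  function of \<open>t\<close>, both integrable by \<open>set_integrable_exp_powr\<close>.
\<close>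

lemma cdarat_existsI:
  assumes "p > 0" "q > 0"
    and meas: "set_borel_measurable lborel ({0<..} \<times> {0<..}) (\<lambda>(x, t). H x t)"
    and bound: "\<And>x t. x > 0 \<Longrightarrow> t > 0 \<Longrightarrow> \<bar>H x t\<bar> \<le> C * exp (a * (x powr p / p) + b * (t powr q / q))"
    and "a < Re r" "b < Re s"
  shows "cdarat_exists p q H r s"
  unfolding cdarat_exists_def set_integrable_def
proof (rule Bochner_Integration.integrable_bound)
  let ?D = "\<lambda>c p x. exp (- c * (x powr p / p)) * x powr (p - 1)"
  have D: "integrable lborel (\<lambda>x. indicator {0<..} x * ?D c p x)" if "p > 0" "c > 0" for c p :: real
    using set_integrable_exp_powr[OF that] by (simp add: set_integrable_def)
  show "integrable lborel (\<lambda>z. C * (case z of (x, t) \<Rightarrow>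
      (indicator {0<..} x * ?D (Re r - a) p x) * (indicator {0<..} t * ?D (Re s - b) q t)))"
    using assms by (intro integrable_mult_right integrable_lborel_tensor D) auto
  have [measurable]: "(\<lambda>z. indicator ({0<..} \<times> {0<..}) z * H (fst z) (snd z)) \<in> borel_measurable borel"
    using meas by (simp add: set_borel_measurable_def case_prod_beta)
  have [measurable]: "fst \<in> borel_measurable (borel :: (real \<times> real) measure)"
    "snd \<in> borel_measurable (borel :: (real \<times> real) measure)"
    by (intro borel_measurable_continuous_onI continuous_intros)+
  have "(\<lambda>z. exp (- r * of_real (fst z powr p / p) - s * of_real (snd z powr q / q))
       * of_real (indicator ({0<..} \<times> {0<..}) z * H (fst z) (snd z))
       * of_real (fst z powr (p - 1)) * of_real (snd z powr (q - 1))) \<in> borel_measurable lborel"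
    by measurable
  then show "(\<lambda>z. indicator ({0<..} \<times> {0<..}) z *\<^sub>R cdarat_integrand p q H r s z)
      \<in> borel_measurable lborel"
    by (rule measurable_cong[THEN iffD1, rotated])
      (auto simp: cdarat_integrand_def indicator_def case_prod_beta)
  show "AE z in lborel. norm (indicator ({0<..} \<times> {0<..}) z *\<^sub>R cdarat_integrand p q H r s z)
      \<le> norm (C * (case z of (x, t) \<Rightarrow>
      (indicator {0<..} x * ?D (Re r - a) p x) * (indicator {0<..} t * ?D (Re s - b) q t)))"
  proof (rule AE_I2, clarify)
    fix x t :: real
    show "norm (indicator ({0<..} \<times> {0<..}) (x, t) *\<^sub>R cdarat_integrand p q H r s (x, t))
      \<le> norm (C * ((indicator {0<..} x * ?D (Re r - a) p x) * (indicator {0<..} t * ?D (Re s - b) q t)))"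
    proof (cases "x > 0 \<and> t > 0")
      case True
      let ?U = "x powr p / p" and ?V = "t powr q / q" and ?w = "x powr (p - 1) * t powr (q - 1)"
      have "norm (cdarat_integrand p q H r s (x, t)) = exp (- Re r * ?U - Re s * ?V) * ?w * \<bar>H x t\<bar>"
        by (simp add: cdarat_integrand_def norm_mult)
      also have "\<dots> \<le> exp (- Re r * ?U - Re s * ?V) * ?w * (C * exp (a * ?U + b * ?V))"
        using True by (intro mult_left_mono bound) auto
      also have "\<dots> = C * (exp (- Re r * ?U - Re s * ?V) * exp (a * ?U + b * ?V)) * ?w"
        by (simp add: mult_ac)
      also have "exp (- Re r * ?U - Re s * ?V) * exp (a * ?U + b * ?V) =
          exp (- (Re r - a) * ?U) * exp (- (Re s - b) * ?V)"
        by (rule exp_mult_exp_shift)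
      also have "C * (exp (- (Re r - a) * ?U) * exp (- (Re s - b) * ?V)) * ?w
          = C * (?D (Re r - a) p x * ?D (Re s - b) q t)"
        by (simp add: mult_ac)
      also have "\<dots> \<le> norm (C * (?D (Re r - a) p x * ?D (Re s - b) q t))"
        unfolding real_norm_def by (rule abs_ge_self)
      finally show ?thesis using True by simp
    qed auto
  qed
qed

lemma cdarat_integrand_eq_cara_integrand:
  "cdarat_integrand p q H r s (x, t) =
     exp (- r * of_real (x powr p / p)) * of_real (x powr (p - 1)) * cara_integrand q (H x) s t"
  by (simp add: cdarat_integrand_def cara_integrand_def exp_diff exp_minus field_simps)

text \<open>
  The double transform is the transform in \<open>x\<close> of the transforms in \<open>t\<close> of the slices. The outer
  transform is written out because its argument is complex-valued. Convergence of the slices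
  follows only for almost every \<open>x\<close>.
\<close>

lemma cdarat_Fubini:
  assumes "cdarat_exists p q H r s"
  shows "AE x in lborel. x > 0 \<longrightarrow> cara_exists q (H x) s"
    and "set_integrable lborel {0<..}
           (\<lambda>x. exp (- r * of_real (x powr p / p)) * of_real (x powr (p - 1)) * cara q (H x) s)"
    and "cdarat p q H r s = r * (LINT x:{0<..}|lborel.
           exp (- r * of_real (x powr p / p)) * of_real (x powr (p - 1)) * cara q (H x) s)"
proof -
  let ?k = "\<lambda>x. exp (- r * of_real (x powr p / p)) * of_real (x powr (p - 1)) :: complex"
  let ?f = "\<lambda>z. indicator ({0<..} \<times> {0<..}) z *\<^sub>R cdarat_integrand p q H r s z"
  have f: "integrable (lborel \<Otimes>\<^sub>M lborel) ?f"
    using assms by (simp add: cdarat_exists_def set_integrable_def lborel_prod)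
  have slice: "?f (x, t) = (indicator {0<..} x *\<^sub>R ?k x) * (indicator {0<..} t *\<^sub>R cara_integrand q (H x) s t)"
    for x t
    by (auto simp: cdarat_integrand_eq_cara_integrand indicator_def)
  have inner: "s * (\<integral>t. ?f (x, t) \<partial>lborel) = indicator {0<..} x *\<^sub>R (?k x * cara q (H x) s)" for x
    unfolding slice integral_mult_right_zero by (simp add: cara_def set_lebesgue_integral_def)
  show "AE x in lborel. x > 0 \<longrightarrow> cara_exists q (H x) s"
    using lborel_pair.AE_integrable_fst'[OF f]
  proof eventually_elim
    case (elim x)
    show ?case
    proof
      assume x: "x > 0"
      then have k: "?k x \<noteq> 0" by auto
      have "integrable lborel (\<lambda>t. inverse (?k x) * ?f (x, t))"
        using elim by (rule integrable_mult_right)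
      moreover have "inverse (?k x) * ?f (x, t) = indicator {0<..} t *\<^sub>R cara_integrand q (H x) s t" for t
        unfolding slice using x k by (simp add: field_simps)
      ultimately show "cara_exists q (H x) s"
        unfolding cara_exists_def set_integrable_def by simp
    qed
  qed
  have "integrable lborel (\<lambda>x. s * (\<integral>t. ?f (x, t) \<partial>lborel))"
    using lborel_pair.integrable_fst'[OF f] by (rule integrable_mult_right)
  then show "set_integrable lborel {0<..} (\<lambda>x. ?k x * cara q (H x) s)"
    unfolding inner set_integrable_def .
  have "cdarat p q H r s = r * (s * (\<integral>x. \<integral>t. ?f (x, t) \<partial>lborel \<partial>lborel))"
    unfolding cdarat_def set_lebesgue_integral_def lborel_pair.integral_fst'[OF f]
    by (simp add: lborel_prod)
  also have "s * (\<integral>x. \<integral>t. ?f (x, t) \<partial>lborel \<partial>lborel) = (\<integral>x. s * (\<integral>t. ?f (x, t) \<partial>lborel) \<partial>lborel)"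
    by simp
  finally show "cdarat p q H r s = r * (LINT x:{0<..}|lborel. ?k x * cara q (H x) s)"
    unfolding inner set_lebesgue_integral_def .
qed

lemma cdarat_integrand_swap:
  "cdarat_integrand q p (\<lambda>t x. F x t) s r (t, x) = cdarat_integrand p q F r s (x, t)"
proof -
  have "- s * of_real (t powr q / q) - r * of_real (x powr p / p) =
      - r * of_real (x powr p / p) - s * of_real (t powr q / q)"
    by simp
  then show ?thesis
    unfolding cdarat_integrand_def by (simp only: case_prod_conv mult_ac)
qed

text \<open>
  If one of the integrals diverges then both do and both have the value 0, so the variables may be
  exchanged for every \<open>F\<close>.
\<close>

lemma
  shows cdarat_exists_swap: "cdarat_exists q p (\<lambda>t x. F x t) s r \<longleftrightarrow> cdarat_exists p q F r s"
    and cdarat_swap: "cdarat q p (\<lambda>t x. F x t) s r = cdarat p q F r s"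
proof -
  let ?f = "\<lambda>z. indicator ({0<..} \<times> {0<..}) z *\<^sub>R cdarat_integrand p q F r s z"
  let ?g = "\<lambda>z. indicator ({0<..} \<times> {0<..}) z *\<^sub>R cdarat_integrand q p (\<lambda>t x. F x t) s r z"
  have g: "?g = (\<lambda>(t, x). ?f (x, t))"
  proof (rule ext, clarify)
    fix t x :: real
    show "indicator ({0<..} \<times> {0<..}) (t, x) *\<^sub>R cdarat_integrand q p (\<lambda>t x. F x t) s r (t, x) =
        indicator ({0<..} \<times> {0<..}) (x, t) *\<^sub>R cdarat_integrand p q F r s (x, t)"
      unfolding cdarat_integrand_swap[of q p F s r t x] by (auto simp: indicator_def)
  qed
  have int: "integrable lborel ?g \<longleftrightarrow> integrable lborel ?f"
    unfolding g using lborel_pair.integrable_product_swap_iff[of ?f] by (simp only: lborel_prod)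
  then show "cdarat_exists q p (\<lambda>t x. F x t) s r \<longleftrightarrow> cdarat_exists p q F r s"
    by (simp add: cdarat_exists_def set_integrable_def)
  have "integral\<^sup>L lborel ?g = integral\<^sup>L lborel ?f"
  proof (cases "integrable lborel ?f")
    case True
    then have "?f \<in> borel_measurable (lborel \<Otimes>\<^sub>M lborel)"
      unfolding lborel_prod by (rule borel_measurable_integrable)
    from lborel_pair.integral_product_swap[OF this] show ?thesis
      unfolding g by (simp only: lborel_prod)
  next
    case False
    then have "\<not> integrable lborel ?g"
      using int by blast
    from not_integrable_integral_eq[OF this] not_integrable_integral_eq[OF False]
    show ?thesis by (rule trans[OF _ sym])
  qed
  then show "cdarat q p (\<lambda>t x. F x t) s r = cdarat p q F r s"
    by (simp add: cdarat_def set_lebesgue_integral_def mult_ac)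
qed

section \<open>Transforms of conformable derivatives\<close>

text \<open>
  The single transform turns the conformable derivative into multiplication by \<open>s\<close>, up to a boundary
  term. The integrand on the left, minus \<open>s\<close> times the one on the right, is the ordinary derivative of
  \<open>E t = exp (- s * (t powr q / q)) * f t\<close>. This derivative may be
  discontinuous, which calls for the gauge integral: \<open>E\<close> is continuous on \<open>[0, T]\<close> and differentiable
  inside, so the integral of the derivative there equals \<open>E T - E 0\<close>. Absolute convergence identifies it with the Lebesgue integral, and \<open>E T\<close> vanishes as \<open>T\<close> grows.
\<close>

lemma cara_conformable_deriv:
  assumes q: "q > 0" and cont: "continuous_on {0..} f"
    and diff: "\<And>t. t > 0 \<Longrightarrow> conformable_differentiable q f t"
    and bound: "\<And>t. t > 0 \<Longrightarrow> \<bar>f t\<bar> \<le> C * exp (b * (t powr q / q))"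
    and s: "b < Re s"
    and ex: "cara_exists q f s" "cara_exists q (conformable_deriv q f) s"
  shows "cara q (conformable_deriv q f) s = s * cara q f s - s * of_real (f 0)"
proof -
  let ?D = "conformable_deriv q f"
  define E where "E = (\<lambda>t. exp (- s * of_real (t powr q / q)) * complex_of_real (f t))"
  define g where "g = (\<lambda>t. cara_integrand q ?D s t - s * cara_integrand q f s t)"
  have g: "set_integrable lborel {0<..} g"
    "(LINT t:{0<..}|lborel. g t) = (LINT t:{0<..}|lborel. cara_integrand q ?D s t)
       - s * (LINT t:{0<..}|lborel. cara_integrand q f s t)"
    using ex unfolding cara_exists_def g_def by auto
  have deriv: "(E has_vector_derivative g t) (at t)" if t: "t > 0" for t
  proof -
    have f: "((\<lambda>t. complex_of_real (f t)) has_vector_derivative of_real (?D t * t powr (q - 1))) (at t)"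
      using conformable_deriv_imp_DERIV[OF diff[OF t] t]
      by (intro has_vector_derivative_of_real) (simp add: has_real_derivative_iff_has_vector_derivative)
    have V: "((\<lambda>t. complex_of_real (t powr q / q)) has_vector_derivative of_real (t powr (q - 1))) (at t)"
      using DERIV_powr_divide[OF q t]
      by (intro has_vector_derivative_of_real) (simp add: has_real_derivative_iff_has_vector_derivative)
    have "((\<lambda>z. exp (- s * z)) has_field_derivative - s * exp (- s * of_real (t powr q / q)))
        (at (of_real (t powr q / q)))"
      by (auto intro!: derivative_eq_intros)
    from field_vector_diff_chain_at[OF V this]
    have "((\<lambda>t. exp (- s * of_real (t powr q / q))) has_vector_derivative
        of_real (t powr (q - 1)) * (- s * exp (- s * of_real (t powr q / q)))) (at t)"
      by (simp add: o_def)
    from has_vector_derivative_mult[OF this f] show ?thesis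
      by (simp add: E_def g_def cara_integrand_def algebra_simps)
  qed
  have contE: "continuous_on {0..T} E" for T
    unfolding E_def using q
    by (intro continuous_intros continuous_on_powr' continuous_on_subset[OF cont]) auto
  have E0: "E 0 = of_real (f 0)"
    using q by (simp add: E_def)
  have FTC: "(\<integral>t. indicator {..T} t *\<^sub>R (indicator {0<..} t *\<^sub>R g t) \<partial>lborel) = E T - E 0" if "T > 0" for T
  proof -
    have "(g has_integral (E T - E 0)) {0..T}"
      using that deriv contE
      by (intro fundamental_theorem_of_calculus_interior_strong[where S = "{}"]) auto
    then have HK: "integral {0<..T} g = E T - E 0"
      by (intro integral_unique, subst has_integral_spike_set_eq[of _ "{0..T}"])
         (auto intro: negligible_subset[of "{0}"])
    have "set_integrable lborel {0<..T} g"
      using g(1) by (rule set_integrable_subset) auto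
    from set_borel_integral_eq_integral(2)[OF this] HK
    have "(LINT t:{0<..T}|lborel. g t) = E T - E 0" by simp
    moreover have "indicator {..T} t *\<^sub>R (indicator {0<..} t *\<^sub>R g t) = indicator {0<..T} t *\<^sub>R g t" for t
      by (auto simp: indicator_def)
    ultimately show ?thesis by (simp only: set_lebesgue_integral_def)
  qed
  have "((\<lambda>T. \<integral>t. indicator {..T} t *\<^sub>R (indicator {0<..} t *\<^sub>R g t) \<partial>lborel) \<longlongrightarrow>
      (LINT t:{0<..}|lborel. g t)) at_top"
    unfolding set_lebesgue_integral_def
    by (rule tendsto_integral_at_top) (use g(1) in \<open>auto simp: set_integrable_def\<close>)
  moreover have "((\<lambda>T. \<integral>t. indicator {..T} t *\<^sub>R (indicator {0<..} t *\<^sub>R g t) \<partial>lborel) \<longlongrightarrow> 0 - E 0) at_top"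
  proof (rule Lim_transform_eventually)
    have "(E \<longlongrightarrow> 0) at_top"
    proof (rule Lim_null_comparison)
      show "\<forall>\<^sub>F t in at_top. norm (E t) \<le> C * exp (- ((Re s - b) * (t powr q / q)))"
        using eventually_gt_at_top[of 0]
      proof eventually_elim
        case (elim t)
        have "norm (E t) = exp (- Re s * (t powr q / q)) * \<bar>f t\<bar>"
          by (simp add: E_def norm_mult)
        also have "\<dots> \<le> exp (- Re s * (t powr q / q)) * (C * exp (b * (t powr q / q)))"
          using elim by (intro mult_left_mono bound) auto
        also have "\<dots> = C * (exp (b * (t powr q / q)) * exp (- Re s * (t powr q / q)))"
          by simp
        also have "\<dots> = C * exp (- ((Re s - b) * (t powr q / q)))"
          unfolding exp_mult_exp_shift by (simp only: mult_minus_left)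
        finally show ?case .
      qed
      have "filterlim (\<lambda>t. (Re s - b) * (t powr q / q)) at_top at_top"
        using q s by (intro filterlim_tendsto_pos_mult_at_top[OF tendsto_const] filterlim_powr_divide_at_top) auto
      then have "((\<lambda>t. exp (- ((Re s - b) * (t powr q / q)))) \<longlongrightarrow> 0) at_top"
        by (intro filterlim_compose[OF exp_at_bot]) (simp add: filterlim_uminus_at_bot)
      then show "((\<lambda>t. C * exp (- ((Re s - b) * (t powr q / q)))) \<longlongrightarrow> 0) at_top"
        by (rule tendsto_mult_right_zero)
    qed
    then show "((\<lambda>T. E T - E 0) \<longlongrightarrow> 0 - E 0) at_top"
      by (intro tendsto_intros)
    show "\<forall>\<^sub>F T in at_top. E T - E 0 = (\<integral>t. indicator {..T} t *\<^sub>R (indicator {0<..} t *\<^sub>R g t) \<partial>lborel)"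
      using eventually_gt_at_top[of 0] by eventually_elim (rule FTC[symmetric])
  qed
  ultimately have "(LINT t:{0<..}|lborel. g t) = - of_real (f 0)"
    unfolding E0 diff_0 by (rule tendsto_unique[OF trivial_limit_at_top_linorder])
  with g(2) have "(LINT t:{0<..}|lborel. cara_integrand q ?D s t) =
      s * (LINT t:{0<..}|lborel. cara_integrand q f s t) - of_real (f 0)"
    by (simp add: algebra_simps)
  then show ?thesis
    by (simp add: cara_def right_diff_distrib)
qed

text \<open>
  The single-variable rule applied to almost every slice and integrated over \<open>x\<close>.
\<close>

lemma cdarat_conformable_dt:
  assumes p: "p > 0" and q: "q > 0"
    and cont: "continuous_on ({0..} \<times> {0..}) (\<lambda>(x, t). F x t)"
    and diff: "\<And>x t. x > 0 \<Longrightarrow> t > 0 \<Longrightarrow> conformable_differentiable q (F x) t"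
    and bound: "\<And>x t. x > 0 \<Longrightarrow> t > 0 \<Longrightarrow>
          \<bar>F x t\<bar> \<le> C * exp (a * (x powr p / p) + b * (t powr q / q))"
    and bound': "\<And>x t. x > 0 \<Longrightarrow> t > 0 \<Longrightarrow>
          \<bar>conformable_deriv q (F x) t\<bar> \<le> C' * exp (a * (x powr p / p) + b * (t powr q / q))"
    and r: "a < Re r" and s: "b < Re s"
  shows "cdarat_exists p q F r s"
    and "cdarat_exists p q (\<lambda>x. conformable_deriv q (F x)) r s"
    and "cara_exists p (\<lambda>x. F x 0) r"
    and "cdarat p q (\<lambda>x. conformable_deriv q (F x)) r s = s * cdarat p q F r s - s * cara p (\<lambda>x. F x 0) r"
proof -
  let ?D = "\<lambda>x. conformable_deriv q (F x)"
  let ?k = "\<lambda>x. exp (- r * of_real (x powr p / p)) * of_real (x powr (p - 1)) :: complex"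
  have cont': "continuous_on ({0<..} \<times> {0<..}) (\<lambda>(x, t). F x t)"
    using cont by (rule continuous_on_subset) auto
  have contx: "continuous_on {0..} (F x)" if "x \<ge> 0" for x
    by (rule continuous_on_compose2[OF cont, of _ "\<lambda>t. (x, t)", unfolded case_prod_conv])
      (use that in \<open>auto intro!: continuous_intros\<close>)
  have contt: "continuous_on {0..} (\<lambda>x. F x 0)"
    by (rule continuous_on_compose2[OF cont, of _ "\<lambda>x. (x, 0)", unfolded case_prod_conv])
      (auto intro!: continuous_intros)
  show exF: "cdarat_exists p q F r s"
  proof (rule cdarat_existsI[OF p q _ bound r s])
    show "set_borel_measurable lborel ({0<..} \<times> {0<..}) (\<lambda>(x, t). F x t)"
      using cont' unfolding set_borel_measurable_def measurable_lborel2
      by (intro borel_measurable_continuous_on_indicator borel_open open_Times) auto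
  qed
  show exD: "cdarat_exists p q ?D r s"
    using cdarat_existsI[OF p q set_borel_measurable_conformable_deriv[OF cont' diff] bound' r s] .
  show ex0: "cara_exists p (\<lambda>x. F x 0) r"
  proof (rule cara_existsI[OF p _ _ r])
    show "set_borel_measurable lborel {0<..} (\<lambda>x. F x 0)"
      unfolding set_borel_measurable_def measurable_lborel2
      by (intro borel_measurable_continuous_on_indicator continuous_on_subset[OF contt]) auto
    \<comment> \<open>The bound is only assumed for positive \<open>t\<close>; continuity carries it over to the axis.\<close>
    show "\<bar>F x 0\<bar> \<le> C * exp (a * (x powr p / p))" if x: "x > 0" for x
    proof (rule tendsto_le[OF trivial_limit_at_right_real])
      show "((\<lambda>t. \<bar>F x t\<bar>) \<longlongrightarrow> \<bar>F x 0\<bar>) (at_right 0)"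
        using contx[of x] x unfolding continuous_on_def
        by (intro tendsto_rabs) (auto intro: tendsto_within_subset)
      have "((\<lambda>t::real. t powr q) \<longlongrightarrow> 0 powr q) (at_right 0)"
        using q by (intro tendsto_powr') (auto simp: eventually_at_filter)
      then have "((\<lambda>t. C * exp (a * (x powr p / p) + b * (t powr q / q)))
          \<longlongrightarrow> C * exp (a * (x powr p / p) + b * (0 / q))) (at_right 0)"
        using q by (intro tendsto_intros) auto
      then show "((\<lambda>t. C * exp (a * (x powr p / p) + b * (t powr q / q)))
          \<longlongrightarrow> C * exp (a * (x powr p / p))) (at_right 0)"
        by simp
      show "\<forall>\<^sub>F t in at_right 0. \<bar>F x t\<bar> \<le> C * exp (a * (x powr p / p) + b * (t powr q / q))"
        using bound[OF x] by (auto simp: eventually_at_filter)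
    qed
  qed
  have slice: "AE x in lborel. x \<in> {0<..} \<longrightarrow>
      ?k x * cara q (?D x) s = s * (?k x * cara q (F x) s) - s * (?k x * of_real (F x 0))"
    using cdarat_Fubini(1)[OF exF] cdarat_Fubini(1)[OF exD]
  proof eventually_elim
    case (elim x)
    show ?case
    proof
      assume "x \<in> {0<..}"
      then have x: "x > 0" by simp
      have "cara q (?D x) s = s * cara q (F x) s - s * of_real (F x 0)"
      proof (rule cara_conformable_deriv[OF q _ _ _ s])
        show "\<bar>F x t\<bar> \<le> C * exp (a * (x powr p / p)) * exp (b * (t powr q / q))" if "t > 0" for t
          using bound[OF x that] by (simp add: exp_add)
      qed (use elim x diff contx in auto)
      then show "?k x * cara q (?D x) s = s * (?k x * cara q (F x) s) - s * (?k x * of_real (F x 0))"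
        by (simp only: right_diff_distrib mult_ac)
    qed
  qed
  have int0: "set_integrable lborel {0<..} (\<lambda>x. ?k x * of_real (F x 0))"
    and eq0: "cara p (\<lambda>x. F x 0) r = r * (LINT x:{0<..}|lborel. ?k x * of_real (F x 0))"
    using ex0 by (simp_all add: cara_exists_def cara_def cara_integrand_def[abs_def] mult_ac)
  note intF = cdarat_Fubini(2)[OF exF] and intD = cdarat_Fubini(2)[OF exD]
  have "(LINT x:{0<..}|lborel. ?k x * cara q (?D x) s) =
      (LINT x:{0<..}|lborel. s * (?k x * cara q (F x) s) - s * (?k x * of_real (F x 0)))"
    unfolding set_lebesgue_integral_def
  proof (rule integral_cong_AE)
    show "(\<lambda>x. indicator {0<..} x *\<^sub>R (?k x * cara q (?D x) s)) \<in> borel_measurable lborel"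
      using intD unfolding set_integrable_def by (rule borel_measurable_integrable)
    have "set_integrable lborel {0<..} (\<lambda>x. s * (?k x * cara q (F x) s) - s * (?k x * of_real (F x 0)))"
      by (intro set_integral_diff(1) set_integrable_mult_right intF int0)
    then show "(\<lambda>x. indicator {0<..} x *\<^sub>R (s * (?k x * cara q (F x) s) - s * (?k x * of_real (F x 0))))
        \<in> borel_measurable lborel"
      unfolding set_integrable_def by (rule borel_measurable_integrable)
    show "AE x in lborel. indicator {0<..} x *\<^sub>R (?k x * cara q (?D x) s) =
        indicator {0<..} x *\<^sub>R (s * (?k x * cara q (F x) s) - s * (?k x * of_real (F x 0)))"
      using slice
    proof eventually_elim
      case (elim x)
      then show ?case by (cases "x \<in> {0<..}") simp_all
    qed
  qed
  also have "\<dots> = s * (LINT x:{0<..}|lborel. ?k x * cara q (F x) s)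
      - s * (LINT x:{0<..}|lborel. ?k x * of_real (F x 0))"
    by (simp only: set_integral_mult_right
        set_integral_diff(2)[OF set_integrable_mult_right[OF intF] set_integrable_mult_right[OF int0]])
  finally show "cdarat p q ?D r s = s * cdarat p q F r s - s * cara p (\<lambda>x. F x 0) r"
    unfolding cdarat_Fubini(3)[OF exF] cdarat_Fubini(3)[OF exD] eq0
    by (simp only: right_diff_distrib mult.left_commute)
qed

section \<open>Differentiation with respect to the transform parameter\<close>

text \<open>
  Differentiation of a Laplace integral under the integral sign, over an arbitrary measure space so
  that it serves the single and the double transform alike. Rather than taking limits of integrals,
  the proof bounds the first-order remainder: by Taylor it is at most \<open>\<bar>w\<bar>\<^sup>2 \<phi>\<^sup>2 exp (\<epsilon> \<phi>)\<close> times
  the integrand, and the gap between \<open>c\<close> and \<open>Re r\<close> pays for \<open>\<phi>\<^sup>2\<close>, so its integral is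
  \<open>O(\<bar>w\<bar>\<^sup>2)\<close>.
\<close>

lemma has_field_derivative_exp_integral:
  fixes M :: "'a measure" and \<phi> :: "'a \<Rightarrow> real" and \<psi> :: "'a \<Rightarrow> complex" and r :: complex
  assumes [measurable]: "\<phi> \<in> borel_measurable M" "\<psi> \<in> borel_measurable M"
    and nonneg: "\<And>z. \<phi> z \<ge> 0"
    and int: "integrable M (\<lambda>z. exp (- of_real c * of_real (\<phi> z)) * \<psi> z)"
    and c: "c < Re r"
  shows "((\<lambda>r. \<integral>z. exp (- r * of_real (\<phi> z)) * \<psi> z \<partial>M) has_field_derivative
      - (\<integral>z. of_real (\<phi> z) * (exp (- r * of_real (\<phi> z)) * \<psi> z) \<partial>M)) (at r)"
proof -
  define \<epsilon> where "\<epsilon> = (Re r - c) / 2"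
  have \<epsilon>: "\<epsilon> > 0" using c by (simp add: \<epsilon>_def)
  define B where "B = (\<lambda>z. norm (exp (- of_real c * of_real (\<phi> z)) * \<psi> z))"
  have B: "integrable M B"
    unfolding B_def using int by (rule integrable_norm)
  have B_eq: "B z = exp (- c * \<phi> z) * norm (\<psi> z)" for z
    by (simp add: B_def norm_mult)
  have quad: "\<phi> z ^ 2 \<le> 2 / \<epsilon>\<^sup>2 * exp (\<epsilon> * \<phi> z)" for z
  proof -
    have "(\<epsilon> * \<phi> z)\<^sup>2 / 2 \<le> exp (\<epsilon> * \<phi> z)"
      using exp_lower_Taylor_quadratic[of "\<epsilon> * \<phi> z"] \<epsilon> nonneg[of z]
      by (smt (verit) mult_nonneg_nonneg)
    then show ?thesis using \<epsilon> by (simp add: field_simps power_mult_distrib)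
  qed
  have lin: "\<phi> z \<le> 1 / \<epsilon> * exp (\<epsilon> * \<phi> z)" for z
  proof -
    have "\<epsilon> * \<phi> z \<le> exp (\<epsilon> * \<phi> z)"
      using exp_ge_add_one_self[of "\<epsilon> * \<phi> z"] by linarith
    then show ?thesis using \<epsilon> by (simp add: field_simps)
  qed
  have int0: "integrable M (\<lambda>z. exp (- w * of_real (\<phi> z)) * \<psi> z)" if "Re w \<ge> c" for w
  proof (rule Bochner_Integration.integrable_bound[OF B])
    show "AE z in M. norm (exp (- w * of_real (\<phi> z)) * \<psi> z) \<le> norm (B z)"
      using that nonneg by (auto simp: B_eq norm_mult intro!: AE_I2 mult_right_mono)
  qed measurable
  have int1: "integrable M (\<lambda>z. of_real (\<phi> z) * (exp (- r * of_real (\<phi> z)) * \<psi> z))"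
  proof (rule Bochner_Integration.integrable_bound[OF integrable_mult_right[OF B, of "1 / \<epsilon>"]])
    show "AE z in M. norm (of_real (\<phi> z) * (exp (- r * of_real (\<phi> z)) * \<psi> z)) \<le> norm (1 / \<epsilon> * B z)"
    proof (rule AE_I2)
      fix z
      \<comment> \<open>One factor \<open>\<phi>\<close> costs a rate of \<open>\<epsilon>\<close>, and \<open>c \<le> Re r - \<epsilon>\<close>.\<close>
      have "\<phi> z * exp (- Re r * \<phi> z) \<le> 1 / \<epsilon> * exp (\<epsilon> * \<phi> z) * exp (- Re r * \<phi> z)"
        using lin by (intro mult_right_mono) auto
      also have "\<dots> = 1 / \<epsilon> * exp ((\<epsilon> - Re r) * \<phi> z)"
        by (simp add: exp_add[symmetric] algebra_simps)
      also have "\<dots> \<le> 1 / \<epsilon> * exp (- c * \<phi> z)"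
      proof -
        have "(\<epsilon> - Re r) * \<phi> z \<le> - c * \<phi> z"
          using c nonneg[of z] by (intro mult_right_mono) (auto simp: \<epsilon>_def field_simps)
        then show ?thesis using \<epsilon> by (intro mult_left_mono) auto
      qed
      finally have "\<phi> z * exp (- Re r * \<phi> z) * norm (\<psi> z) \<le> 1 / \<epsilon> * exp (- c * \<phi> z) * norm (\<psi> z)"
        by (rule mult_right_mono) simp
      then show "norm (of_real (\<phi> z) * (exp (- r * of_real (\<phi> z)) * \<psi> z)) \<le> norm (1 / \<epsilon> * B z)"
        using \<epsilon> nonneg[of z] by (simp add: B_eq norm_mult algebra_simps)
    qed
  qed measurable
  define I where "I = (\<lambda>w. \<integral>z. exp (- w * of_real (\<phi> z)) * \<psi> z \<partial>M)"
  define J where "J = (\<integral>z. of_real (\<phi> z) * (exp (- r * of_real (\<phi> z)) * \<psi> z) \<partial>M)"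
  \<comment> \<open>The rate \<open>Re r - 2 * \<epsilon> = c\<close> is left after paying \<open>\<epsilon>\<close> for \<open>\<bar>w\<bar> \<le> \<epsilon>\<close> and \<open>\<epsilon>\<close> for \<open>\<phi>\<^sup>2\<close>.\<close>
  have remainder: "norm (I (r + w) - I r + w * J) \<le> norm w ^ 2 * (2 / \<epsilon>\<^sup>2 * integral\<^sup>L M B)"
    if w: "norm w \<le> \<epsilon>" for w
  proof -
    have "Re (r + w) \<ge> c"
      using w c abs_Re_le_cmod[of w] by (simp add: \<epsilon>_def)
    note ints = int0[OF this] int0[of r] int1
    define R where "R = (\<lambda>z. exp (- (r + w) * of_real (\<phi> z)) * \<psi> z - exp (- r * of_real (\<phi> z)) * \<psi> z
        + w * (of_real (\<phi> z) * (exp (- r * of_real (\<phi> z)) * \<psi> z)))"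
    have R: "integrable M R" "I (r + w) - I r + w * J = integral\<^sup>L M R"
      using ints c unfolding R_def I_def J_def by auto
    have "norm (R z) \<le> norm w ^ 2 * (2 / \<epsilon>\<^sup>2) * B z" for z
    proof -
      let ?y = "- w * of_real (\<phi> z)"
      have "R z = (exp ?y - (\<Sum>k\<le>1. ?y ^ k / fact k)) * (exp (- r * of_real (\<phi> z)) * \<psi> z)"
        by (simp add: R_def algebra_simps exp_add[symmetric] exp_diff field_simps)
      then have "norm (R z) = norm (exp ?y - (\<Sum>k\<le>1. ?y ^ k / fact k)) *
          (exp (- Re r * \<phi> z) * norm (\<psi> z))"
        by (simp add: norm_mult)
      also have "norm (exp ?y - (\<Sum>k\<le>1. ?y ^ k / fact k)) \<le> exp \<bar>Re ?y\<bar> * norm ?y ^ Suc 1 / fact 1"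
        by (rule Taylor_exp)
      also have "\<dots> \<le> exp (\<epsilon> * \<phi> z) * (norm w ^ 2 * \<phi> z ^ 2)"
      proof -
        have "\<bar>Re ?y\<bar> \<le> \<epsilon> * \<phi> z"
          using w abs_Re_le_cmod[of w] nonneg[of z] by (auto simp: abs_mult intro!: mult_right_mono)
        then have "exp \<bar>Re ?y\<bar> * (norm w ^ 2 * \<phi> z ^ 2) \<le> exp (\<epsilon> * \<phi> z) * (norm w ^ 2 * \<phi> z ^ 2)"
          by (intro mult_right_mono) auto
        moreover have "norm ?y ^ Suc 1 / fact 1 = norm w ^ 2 * \<phi> z ^ 2"
          using nonneg[of z] by (simp add: norm_mult power2_eq_square)
        ultimately show ?thesis by (simp only: times_divide_eq_right[symmetric])
      qed
      also have "\<dots> \<le> exp (\<epsilon> * \<phi> z) * (norm w ^ 2 * (2 / \<epsilon>\<^sup>2 * exp (\<epsilon> * \<phi> z)))"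
        using quad by (intro mult_left_mono) auto
      finally have "norm (R z) \<le> exp (\<epsilon> * \<phi> z) * (norm w ^ 2 * (2 / \<epsilon>\<^sup>2 * exp (\<epsilon> * \<phi> z))) *
          (exp (- Re r * \<phi> z) * norm (\<psi> z))"
        by (simp add: mult_right_mono)
      also have "\<dots> = norm w ^ 2 * (2 / \<epsilon>\<^sup>2) *
          (exp (\<epsilon> * \<phi> z) * exp (\<epsilon> * \<phi> z) * exp (- Re r * \<phi> z) * norm (\<psi> z))"
        by (simp add: mult_ac)
      also have "exp (\<epsilon> * \<phi> z) * exp (\<epsilon> * \<phi> z) * exp (- Re r * \<phi> z) = exp (- c * \<phi> z)"
        by (simp add: exp_add[symmetric] \<epsilon>_def algebra_simps add_divide_distrib diff_divide_distrib)
      finally show ?thesis by (simp add: B_eq)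
    qed
    then have "norm (integral\<^sup>L M R) \<le> (\<integral>z. norm w ^ 2 * (2 / \<epsilon>\<^sup>2) * B z \<partial>M)"
      using R(1) B by (intro order_trans[OF integral_norm_bound integral_mono]) auto
    then show ?thesis using R(2) by (simp add: mult_ac)
  qed
  have "((\<lambda>w. (I (r + w) - I r) / w - (- J)) \<longlongrightarrow> 0) (at 0)"
  proof (rule Lim_null_comparison)
    show "\<forall>\<^sub>F w in at 0. norm ((I (r + w) - I r) / w - (- J)) \<le> norm w * (2 / \<epsilon>\<^sup>2 * integral\<^sup>L M B)"
      unfolding eventually_at
    proof (intro exI[of _ \<epsilon>] conjI ballI impI)
      fix w :: complex assume w: "w \<noteq> 0 \<and> dist w 0 < \<epsilon>"
      have "(I (r + w) - I r) / w - (- J) = (I (r + w) - I r + w * J) / w"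
        using w by (simp add: field_simps)
      also have "norm \<dots> \<le> norm w ^ 2 * (2 / \<epsilon>\<^sup>2 * integral\<^sup>L M B) / norm w"
        unfolding norm_divide using w by (intro divide_right_mono remainder) auto
      finally show "norm ((I (r + w) - I r) / w - (- J)) \<le> norm w * (2 / \<epsilon>\<^sup>2 * integral\<^sup>L M B)"
        using w by (simp add: power2_eq_square)
    qed (use \<epsilon> in auto)
    show "((\<lambda>w. norm w * (2 / \<epsilon>\<^sup>2 * integral\<^sup>L M B)) \<longlongrightarrow> 0) (at (0::complex))"
      by (rule tendsto_eq_intros tendsto_mult_left_zero tendsto_norm_zero | simp)+
  qed
  then show ?thesis
    unfolding DERIV_def LIM_zero_iff I_def J_def .
qed

text \<open>
  Division by \<open>r\<close> removes the prefactor of the transform and leaves a Laplace integral in \<open>r\<close>, whose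
  derivative brings down \<open>- x powr p / p\<close>. Convergence at one real \<open>c\<close> to the left of \<open>Re r\<close> gives the
  room needed around \<open>r\<close>.
\<close>

lemma has_field_derivative_cdarat_divide:
  assumes "p > 0" "r \<noteq> 0" "c < Re r" and ex: "cdarat_exists p q F (of_real c) s"
  shows "((\<lambda>r'. 1 / r' * cdarat p q F r' s) has_field_derivative
      - (1 / r * cdarat p q (\<lambda>x t. x powr p / p * F x t) r s)) (at r)"
proof -
  let ?Q = "{0<..} \<times> {0<..} :: (real \<times> real) set"
  define \<phi> where "\<phi> = (\<lambda>z :: real \<times> real. fst z powr p / p)"
  define \<psi> where "\<psi> = (\<lambda>z :: real \<times> real. indicator ?Q z *\<^sub>R
      (exp (- s * of_real (snd z powr q / q)) * of_real (F (fst z) (snd z))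
        * of_real (fst z powr (p - 1)) * of_real (snd z powr (q - 1))) :: complex)"
  have \<psi>: "exp (- w * of_real (\<phi> z)) * \<psi> z = indicator ?Q z *\<^sub>R cdarat_integrand p q F w s z" for w z
    by (auto simp: \<phi>_def \<psi>_def cdarat_integrand_def case_prod_beta exp_diff exp_minus field_simps)
  have \<phi>\<psi>: "of_real (\<phi> z) * (exp (- w * of_real (\<phi> z)) * \<psi> z) =
      indicator ?Q z *\<^sub>R cdarat_integrand p q (\<lambda>x t. x powr p / p * F x t) w s z" for w z
    unfolding \<psi> by (simp add: \<phi>_def cdarat_integrand_def case_prod_beta mult_ac)
  have [measurable]: "fst \<in> borel_measurable (borel :: (real \<times> real) measure)"
    by (intro borel_measurable_continuous_onI continuous_intros)
  have meas_\<phi> [measurable]: "\<phi> \<in> borel_measurable lborel"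
    unfolding \<phi>_def by measurable
  have int: "integrable lborel (\<lambda>z. exp (- of_real c * of_real (\<phi> z)) * \<psi> z)"
    using ex unfolding \<psi> cdarat_exists_def set_integrable_def .
  then have [measurable]: "(\<lambda>z. exp (- of_real c * of_real (\<phi> z)) * \<psi> z) \<in> borel_measurable lborel"
    by (rule borel_measurable_integrable)
  have "(\<lambda>z. exp (of_real c * of_real (\<phi> z)) * (exp (- of_real c * of_real (\<phi> z)) * \<psi> z))
      \<in> borel_measurable lborel"
    by measurable
  then have meas_\<psi>: "\<psi> \<in> borel_measurable lborel"
    by (simp add: mult.assoc[symmetric] exp_add[symmetric])
  have "\<phi> z \<ge> 0" for z
    using assms(1) by (simp add: \<phi>_def)
  from has_field_derivative_exp_integral[OF meas_\<phi> meas_\<psi> this int assms(3)]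
  have "((\<lambda>w. s * (LINT z:?Q|lborel. cdarat_integrand p q F w s z)) has_field_derivative
      s * - (LINT z:?Q|lborel. cdarat_integrand p q (\<lambda>x t. x powr p / p * F x t) r s z)) (at r)"
    unfolding \<phi>\<psi> unfolding \<psi> set_lebesgue_integral_def by (rule DERIV_cmult)
  moreover have "s * - (LINT z:?Q|lborel. cdarat_integrand p q (\<lambda>x t. x powr p / p * F x t) r s z)
      = - (1 / r * cdarat p q (\<lambda>x t. x powr p / p * F x t) r s)"
    using assms(2) by (simp add: cdarat_def)
  ultimately have "((\<lambda>w. s * (LINT z:?Q|lborel. cdarat_integrand p q F w s z)) has_field_derivative
      - (1 / r * cdarat p q (\<lambda>x t. x powr p / p * F x t) r s)) (at r)"
    by simp
  then show ?thesis
    by (rule has_field_derivative_transform_within_open[where S = "- {0}"])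
      (use assms(2) in \<open>auto simp: cdarat_def\<close>)
qed

lemma has_field_derivative_cara_divide:
  assumes "p > 0" "r \<noteq> 0" "c < Re r" and ex: "cara_exists p f (of_real c)"
  shows "((\<lambda>r'. 1 / r' * cara p f r') has_field_derivative
      - (1 / r * cara p (\<lambda>x. x powr p / p * f x) r)) (at r)"
proof -
  define \<phi> where "\<phi> = (\<lambda>x :: real. x powr p / p)"
  define \<psi> where "\<psi> = (\<lambda>x :: real. indicator {0<..} x *\<^sub>R
      (of_real (f x) * of_real (x powr (p - 1))) :: complex)"
  have \<psi>: "exp (- w * of_real (\<phi> x)) * \<psi> x = indicator {0<..} x *\<^sub>R cara_integrand p f w x" for w x
    by (simp add: \<phi>_def \<psi>_def cara_integrand_def)
  have \<phi>\<psi>: "of_real (\<phi> x) * (exp (- w * of_real (\<phi> x)) * \<psi> x) =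
      indicator {0<..} x *\<^sub>R cara_integrand p (\<lambda>x. x powr p / p * f x) w x" for w x
    unfolding \<psi> by (simp add: \<phi>_def cara_integrand_def mult_ac)
  have meas_\<phi> [measurable]: "\<phi> \<in> borel_measurable lborel"
    unfolding \<phi>_def by measurable
  have int: "integrable lborel (\<lambda>x. exp (- of_real c * of_real (\<phi> x)) * \<psi> x)"
    using ex unfolding \<psi> cara_exists_def set_integrable_def .
  then have [measurable]: "(\<lambda>x. exp (- of_real c * of_real (\<phi> x)) * \<psi> x) \<in> borel_measurable lborel"
    by (rule borel_measurable_integrable)
  have "(\<lambda>x. exp (of_real c * of_real (\<phi> x)) * (exp (- of_real c * of_real (\<phi> x)) * \<psi> x))
      \<in> borel_measurable lborel"
    by measurable
  then have meas_\<psi>: "\<psi> \<in> borel_measurable lborel"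
    by (simp add: mult.assoc[symmetric] exp_add[symmetric])
  have "\<phi> x \<ge> 0" for x
    using assms(1) by (simp add: \<phi>_def)
  from has_field_derivative_exp_integral[OF meas_\<phi> meas_\<psi> this int assms(3)]
  have "((\<lambda>w. LINT x:{0<..}|lborel. cara_integrand p f w x) has_field_derivative
      - (LINT x:{0<..}|lborel. cara_integrand p (\<lambda>x. x powr p / p * f x) r x)) (at r)"
    unfolding \<phi>\<psi> unfolding \<psi> set_lebesgue_integral_def .
  moreover have "(LINT x:{0<..}|lborel. cara_integrand p (\<lambda>x. x powr p / p * f x) r x)
      = 1 / r * cara p (\<lambda>x. x powr p / p * f x) r"
    using assms(2) by (simp add: cara_def)
  ultimately have "((\<lambda>w. LINT x:{0<..}|lborel. cara_integrand p f w x) has_field_derivative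
      - (1 / r * cara p (\<lambda>x. x powr p / p * f x) r)) (at r)"
    by simp
  then show ?thesis
    by (rule has_field_derivative_transform_within_open[where S = "- {0}"])
      (use assms(2) in \<open>auto simp: cara_def\<close>)
qed

section \<open>Exponential order and the transform of a weighted derivative\<close>

lemma exponential_orderD:
  assumes "exponential_order a b h"
  obtains C where "C \<ge> 0" "\<And>u v. u > 0 \<Longrightarrow> v > 0 \<Longrightarrow> \<bar>h u v\<bar> \<le> C * exp (a * u + b * v)"
proof -
  obtain C where C: "\<And>u v. u > 0 \<Longrightarrow> v > 0 \<Longrightarrow> \<bar>h u v\<bar> / exp (a * u + b * v) \<le> C"
    using assms unfolding exponential_order_def bdd_above_def by auto
  have "0 \<le> \<bar>h 1 1\<bar> / exp (a * 1 + b * 1)" by simp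
  also have "\<dots> \<le> C" by (rule C) auto
  finally have "C \<ge> 0" .
  with C show ?thesis
    by (intro that[of C]) (simp_all add: pos_divide_le_eq)
qed

lemma exponential_order_swap:
  assumes "exponential_order a b h"
  shows "exponential_order b a (\<lambda>v u. h u v)"
proof -
  obtain C where C: "\<And>u v. u > 0 \<Longrightarrow> v > 0 \<Longrightarrow> \<bar>h u v\<bar> \<le> C * exp (a * u + b * v)"
    using assms by (rule exponential_orderD) blast
  show ?thesis
    unfolding exponential_order_def bdd_above_def
    using C by (auto intro!: exI[of _ C] simp: pos_divide_le_eq add.commute)
qed

text \<open>
  The factor \<open>x powr p / p\<close> is constant in \<open>t\<close>, so the transform of the weighted derivative is that of the
  conformable \<open>t\<close>-derivative of \<open>UF x t = x powr p / p * F x t\<close>. The rule for derivatives expresses it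
  by transforms of \<open>UF\<close>, and these are derivatives in \<open>r\<close> of the transforms of \<open>F\<close>. The weighted
  functions have growth rate \<open>c\<close> in \<open>x\<close> for any \<open>c\<close> strictly between \<open>a\<close> and \<open>Re r\<close>.
\<close>

lemma cdarat_powr_mult_conformable_dt:
  fixes p q :: real and h :: "real \<Rightarrow> real \<Rightarrow> real"
  defines "F \<equiv> \<lambda>x t. h (x powr p / p) (t powr q / q)"
  assumes p: "p > 0" and q: "q > 0"
    and cont: "continuous_on ({0..} \<times> {0..}) (\<lambda>(u, v). h u v)"
    and order: "exponential_order a b h"
    and r: "r \<noteq> 0" "a < Re r" and s: "b < Re s"
    and diff: "\<And>x t. x > 0 \<Longrightarrow> t > 0 \<Longrightarrow> conformable_differentiable q (F x) t"
    and order': "exponential_order a b (as_function_of_uv p q (conformable_dt p q h))"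
  shows "cdarat_exists p q (\<lambda>x t. x powr p / p * conformable_dt p q h x t) r s \<and>
    cdarat_exists p q F r s \<and>
    cara_exists p (\<lambda>x. h (x powr p / p) 0) r \<and>
    (\<lambda>r'. 1 / r' * cdarat p q F r' s) field_differentiable (at r) \<and>
    (\<lambda>r'. 1 / r' * cara p (\<lambda>x. h (x powr p / p) 0) r') field_differentiable (at r) \<and>
    cdarat p q (\<lambda>x t. x powr p / p * conformable_dt p q h x t) r s =
      - r * s * deriv (\<lambda>r'. 1 / r' * cdarat p q F r' s) r
      + r * s * deriv (\<lambda>r'. 1 / r' * cara p (\<lambda>x. h (x powr p / p) 0) r') r"
proof -
  define UF where "UF = (\<lambda>x t. x powr p / p * F x t)"
  have dt: "conformable_dt p q h = (\<lambda>x. conformable_deriv q (F x))"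
    by (simp add: fun_eq_iff conformable_dt_def conformable_arg_def F_def)
  have F0: "F x 0 = h (x powr p / p) 0" for x
    using q by (simp add: F_def)
  obtain C where C: "C \<ge> 0" "\<And>u v. u > 0 \<Longrightarrow> v > 0 \<Longrightarrow> \<bar>h u v\<bar> \<le> C * exp (a * u + b * v)"
    using exponential_orderD[OF order] by blast
  obtain C' where C': "C' \<ge> 0" "\<And>u v. u > 0 \<Longrightarrow> v > 0 \<Longrightarrow>
      \<bar>as_function_of_uv p q (conformable_dt p q h) u v\<bar> \<le> C' * exp (a * u + b * v)"
    using exponential_orderD[OF order'] by blast
  have bound: "\<bar>F x t\<bar> \<le> C * exp (a * (x powr p / p) + b * (t powr q / q))" if "x > 0" "t > 0" for x t
    unfolding F_def using that p q by (intro C) auto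
  have bound': "\<bar>conformable_deriv q (F x) t\<bar> \<le> C' * exp (a * (x powr p / p) + b * (t powr q / q))"
    if "x > 0" "t > 0" for x t
    using C'(2)[of "x powr p / p" "t powr q / q"] that p q
    by (simp add: as_function_of_uv_def dt powr_powr)
  have contF: "continuous_on ({0..} \<times> {0..}) (\<lambda>(x, t). F x t)"
  proof -
    have "continuous_on ({0..} \<times> {0..}) (\<lambda>z. h (fst z powr p / p) (snd z powr q / q))"
      by (rule continuous_on_compose2[OF cont, of _ "\<lambda>z. (fst z powr p / p, snd z powr q / q)",
            unfolded case_prod_conv])
        (use p q in \<open>auto intro!: continuous_intros continuous_on_powr'\<close>)
    then show ?thesis by (simp add: F_def case_prod_beta)
  qed
  have contUF: "continuous_on ({0..} \<times> {0..}) (\<lambda>(x, t). UF x t)"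
    using contF p unfolding UF_def case_prod_beta
    by (intro continuous_intros continuous_on_powr') auto
  obtain c where c: "a < c" "c < Re r"
    using r(2) dense by blast
  have weight: "\<bar>x powr p / p * y\<bar> \<le> B / (c - a) * exp (c * (x powr p / p) + b * v)"
    if "\<bar>y\<bar> \<le> B * exp (a * (x powr p / p) + b * v)" "B \<ge> 0" for x y v B :: real
  proof -
    have "\<bar>x powr p / p * y\<bar> \<le> x powr p / p * (B * exp (a * (x powr p / p) + b * v))"
      using that p by (simp add: abs_mult divide_right_mono mult_left_mono)
    also have "\<dots> = B * (x powr p / p * exp (a * (x powr p / p) + b * v))"
      by simp
    also have "\<dots> \<le> B * (1 / (c - a) * exp (c * (x powr p / p) + b * v))"
      using that by (intro mult_left_mono mult_exp_le_exp c)
    finally show ?thesis by simp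
  qed
  have UF': "conformable_differentiable q (UF x) t"
    "conformable_deriv q (UF x) t = x powr p / p * conformable_deriv q (F x) t" if "x > 0" "t > 0" for x t
    unfolding UF_def by (rule conformable_deriv_cmult[OF diff[OF that]])+
  have boundUF: "\<bar>UF x t\<bar> \<le> C / (c - a) * exp (c * (x powr p / p) + b * (t powr q / q))"
    if "x > 0" "t > 0" for x t
    unfolding UF_def by (rule weight[OF bound[OF that] C(1)])
  have boundUF': "\<bar>conformable_deriv q (UF x) t\<bar> \<le> C' / (c - a) * exp (c * (x powr p / p) + b * (t powr q / q))"
    if "x > 0" "t > 0" for x t
    unfolding UF'(2)[OF that] by (rule weight[OF bound'[OF that] C'(1)])
  have F: "cdarat_exists p q F w s" "cara_exists p (\<lambda>x. F x 0) w" if "a < Re w" for w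
    using cdarat_conformable_dt(1,3)[OF p q contF _ _ _ that s] diff bound bound' by blast+
  have UF: "cdarat_exists p q (\<lambda>x. conformable_deriv q (UF x)) r s"
    "cdarat p q (\<lambda>x. conformable_deriv q (UF x)) r s = s * cdarat p q UF r s - s * cara p (\<lambda>x. UF x 0) r"
    using cdarat_conformable_dt(2,4)[OF p q contUF _ _ _ c(2) s] UF'(1) boundUF boundUF' by blast+
  \<comment> \<open>The derivatives of \<open>UF\<close> and of \<open>h\<close> are related on the open quadrant only, so the comparison includes its indicator.\<close>
  have int_eq: "indicator ({0<..} \<times> {0<..}) z *\<^sub>R cdarat_integrand p q (\<lambda>x. conformable_deriv q (UF x)) r s z
     = indicator ({0<..} \<times> {0<..}) z *\<^sub>R
         cdarat_integrand p q (\<lambda>x t. x powr p / p * conformable_dt p q h x t) r s z" for z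
    by (cases z) (auto simp: cdarat_integrand_def indicator_def UF' dt)
  have ex: "cdarat_exists p q (\<lambda>x t. x powr p / p * conformable_dt p q h x t) r s"
    using UF(1) unfolding cdarat_exists_def set_integrable_def int_eq .
  have eq: "cdarat p q (\<lambda>x t. x powr p / p * conformable_dt p q h x t) r s =
      s * cdarat p q UF r s - s * cara p (\<lambda>x. UF x 0) r"
    using UF(2) unfolding cdarat_def set_lebesgue_integral_def int_eq .
  have "a < Re (complex_of_real c)"
    using c by simp
  note exc = F[OF this]
  have D: "((\<lambda>r'. 1 / r' * cdarat p q F r' s) has_field_derivative - (1 / r * cdarat p q UF r s)) (at r)"
    unfolding UF_def by (rule has_field_derivative_cdarat_divide[OF p r(1) c(2) exc(1)])
  have D0: "((\<lambda>r'. 1 / r' * cara p (\<lambda>x. h (x powr p / p) 0) r') has_field_derivative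
      - (1 / r * cara p (\<lambda>x. UF x 0) r)) (at r)"
    using has_field_derivative_cara_divide[OF p r(1) c(2) exc(2)] unfolding UF_def F0 .
  have "cdarat p q (\<lambda>x t. x powr p / p * conformable_dt p q h x t) r s =
      - r * s * deriv (\<lambda>r'. 1 / r' * cdarat p q F r' s) r
      + r * s * deriv (\<lambda>r'. 1 / r' * cara p (\<lambda>x. h (x powr p / p) 0) r') r"
    unfolding DERIV_imp_deriv[OF D] DERIV_imp_deriv[OF D0] eq using r(1) by simp
  then show ?thesis
    using ex F[OF r(2)] D D0 unfolding F0 field_differentiable_def by blast
qed

theorem theorem5:
  fixes p q a b :: real and h :: "real \<Rightarrow> real \<Rightarrow> real" and r s :: complex
  assumes "0 < p" "p \<le> 1" "0 < q" "q \<le> 1"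
    and "continuous_on ({0..} \<times> {0..}) (\<lambda>(u, v). h u v)"
    and "exponential_order a b h"
    and "r \<noteq> 0" "s \<noteq> 0" "Re r > a" "Re s > b"
  defines "G \<equiv> cdarat p q (\<lambda>x t. h (x powr p / p) (t powr q / q))"
    and "Gx0 \<equiv> cara p (\<lambda>x. h (x powr p / p) 0)"
    and "Gt0 \<equiv> cara q (\<lambda>t. h 0 (t powr q / q))"
  shows
    "((\<forall>x>0. \<forall>t>0. conformable_differentiable q (\<lambda>t'. h (x powr p / p) (t' powr q / q)) t) \<and>
      piecewise_continuous (as_function_of_uv p q (conformable_dt p q h)) \<and>
      exponential_order a b (as_function_of_uv p q (conformable_dt p q h))
      \<longrightarrow>
      cdarat_exists p q (\<lambda>x t. x powr p / p * conformable_dt p q h x t) r s \<and>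
      cdarat_exists p q (\<lambda>x t. h (x powr p / p) (t powr q / q)) r s \<and>
      cara_exists p (\<lambda>x. h (x powr p / p) 0) r \<and>
      (\<lambda>r'. 1 / r' * G r' s) field_differentiable (at r) \<and>
      (\<lambda>r'. 1 / r' * Gx0 r') field_differentiable (at r) \<and>
      cdarat p q (\<lambda>x t. x powr p / p * conformable_dt p q h x t) r s =
        - r * s * deriv (\<lambda>r'. 1 / r' * G r' s) r + r * s * deriv (\<lambda>r'. 1 / r' * Gx0 r') r)
     \<and>
     ((\<forall>x>0. \<forall>t>0. conformable_differentiable p (\<lambda>x'. h (x' powr p / p) (t powr q / q)) x) \<and>
      piecewise_continuous (as_function_of_uv p q (conformable_dx p q h)) \<and>
      exponential_order a b (as_function_of_uv p q (conformable_dx p q h))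
      \<longrightarrow>
      cdarat_exists p q (\<lambda>x t. t powr q / q * conformable_dx p q h x t) r s \<and>
      cdarat_exists p q (\<lambda>x t. h (x powr p / p) (t powr q / q)) r s \<and>
      cara_exists q (\<lambda>t. h 0 (t powr q / q)) s \<and>
      (\<lambda>s'. 1 / s' * G r s') field_differentiable (at s) \<and>
      (\<lambda>s'. 1 / s' * Gt0 s') field_differentiable (at s) \<and>
      cdarat p q (\<lambda>x t. t powr q / q * conformable_dx p q h x t) r s =
        - r * s * deriv (\<lambda>s'. 1 / s' * G r s') s + r * s * deriv (\<lambda>s'. 1 / s' * Gt0 s') s)"
    (is "(?A \<longrightarrow> ?B) \<and> (?A' \<longrightarrow> ?B')")
proof (intro conjI[of "?A \<longrightarrow> ?B"] impI)
  assume A: ?A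
  show ?B
    unfolding G_def Gx0_def
    by (rule cdarat_powr_mult_conformable_dt[of p q h a b]) (use assms A in auto)
next
  assume A: ?A'
  let ?h = "\<lambda>v u. h u v"
  have cont: "continuous_on ({0..} \<times> {0..}) (\<lambda>(v, u). ?h v u)"
    unfolding case_prod_beta
    by (rule continuous_on_compose2[OF assms(5), of _ "\<lambda>z. (snd z, fst z)", unfolded case_prod_conv])
      (auto intro!: continuous_intros)
  have dx: "conformable_dt q p ?h t x = conformable_dx p q h x t" for x t
    by (simp add: conformable_dt_def conformable_dx_def conformable_arg_def)
  have uv: "as_function_of_uv q p (conformable_dt q p ?h) =
      (\<lambda>v u. as_function_of_uv p q (conformable_dx p q h) u v)"
    by (simp add: fun_eq_iff as_function_of_uv_def dx)
  have order': "exponential_order b a (as_function_of_uv q p (conformable_dt q p ?h))"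
    unfolding uv using A by (blast intro: exponential_order_swap[of a b])
  have diff: "conformable_differentiable p (\<lambda>x'. h (x' powr p / p) (t powr q / q)) x"
    if "t > 0" "x > 0" for t x
    using A that by blast
  show ?B'
    using cdarat_powr_mult_conformable_dt[OF assms(3,1) cont exponential_order_swap[OF assms(6)]
        assms(8,10,9) diff order']
    unfolding G_def Gt0_def dx
      cdarat_exists_swap[of q p "\<lambda>x t. t powr q / q * conformable_dx p q h x t" s r]
      cdarat_exists_swap[of q p "\<lambda>x t. h (x powr p / p) (t powr q / q)" s r]
      cdarat_swap[of q p "\<lambda>x t. t powr q / q * conformable_dx p q h x t" _ r]
      cdarat_swap[of q p "\<lambda>x t. h (x powr p / p) (t powr q / q)" _ r]
    by (auto simp: mult_ac)
qed

end
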